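(* Let $S\subset\mathbb{F}_2^n$ be nonempty. If $S$ is fully balanced, i.e. $B(S)\cup C(S)=\mathbb{F}_2^n$, then $S$ is either a vector subspace or an affine subspace of $\mathbb{F}_2^n$.
   Context: For $\mathbf{x},\mathbf{y}\in\mathbb{F}_2^n$ the pairing is $\mathbf{x}\cdot\mathbf{y}=\sum_{i=1}^n x_iy_i\in\mathbb{F}_2$, and $H_{\mathbf{y}}=\{\mathbf{x}\in\mathbb{F}_2^n\mid \mathbf{x}\cdot\mathbf{y}=0\}$. For a nonzero $\mathbf{y}$, a set $S$ is $\mathbf{y}$-balanced if $\#(S\cap H_{\mathbf{y}})=\#S/2$. $S$ is $\mathbf{y}$-constant if $S\subset H_{\mathbf{y}}$ or $S\cap H_{\mathbf{y}}=\emptyset$. The balancing set $B(S)$ is the set of nonzero $\mathbf{y}$ such that $S$ is $\mathbf{y}$-balanced; the constant set $C(S)$ is the set of $\mathbf{y}\in\mathbb{F}_2^n$ such that $S$ is $\mathbf{y}$-constant. *)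

theory Defs
  imports "HOL-Analysis.Analysis" "HOL-Library.Z2"
begin

(* With this instance every set of vectors is finite, so that card is the true number of elements. *)
instance bit :: finite
proof
  have "(UNIV :: bit set) = {0, 1}"
    using bit_not_zero_iff by auto
  then show "finite (UNIV :: bit set)"
    by (metis finite.emptyI finite.insertI)
qed

definition hyperplane :: "bit ^ 'n \<Rightarrow> (bit ^ 'n) set" where
  "hyperplane y = {x. scalar_product x y = 0}"

definition balanced_wrt :: "bit ^ 'n \<Rightarrow> (bit ^ 'n) set \<Rightarrow> bool" where
  "balanced_wrt y S \<longleftrightarrow> real (card (S \<inter> hyperplane y)) = real (card S) / 2"

definition constant_wrt :: "bit ^ 'n \<Rightarrow> (bit ^ 'n) set \<Rightarrow> bool" where
  "constant_wrt y S \<longleftrightarrow> S \<subseteq> hyperplane y \<or> S \<inter> hyperplane y = {}"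

definition balancing_set :: "(bit ^ 'n) set \<Rightarrow> (bit ^ 'n) set" where
  "balancing_set S = {y. y \<noteq> 0 \<and> balanced_wrt y S}"

(* The zero vector is not excluded here: every S is constant with respect to it. *)
definition constant_set :: "(bit ^ 'n) set \<Rightarrow> (bit ^ 'n) set" where
  "constant_set S = {y. constant_wrt y S}"

definition fully_balanced :: "(bit ^ 'n) set \<Rightarrow> bool" where
  "fully_balanced S \<longleftrightarrow> balancing_set S \<union> constant_set S = UNIV"

(* The library predicate affine is restricted to real vector spaces. *)
definition affine_subspace :: "(bit ^ 'n) set \<Rightarrow> bool" where
  "affine_subspace S \<longleftrightarrow> (\<exists>v W. vec.subspace W \<and> S = (\<lambda>w. v + w) ` W)"

end

theory Submission
  imports Defs
begin

text \<open>Fix \<open>a \<in> S\<close> and let \<open>W\<close> be the annihilator of \<open>C(S)\<close>; clearly \<open>S \<subseteq> a + W\<close>. For \<open>v \<in> a + W\<close>,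
  the double sum of \<open>(-1)^((v + s) \<cdot> y)\<close> over \<open>s \<in> S\<close> and all \<open>y\<close> is positive: each \<open>y \<in> C(S)\<close> contributes
  \<open>card S\<close> and each \<open>y \<in> B(S)\<close> contributes \<open>0\<close>. By orthogonality of characters the same sum
  vanishes when \<open>v \<notin> S\<close>, so \<open>S = a + W\<close>.\<close>

text \<open>The nontrivial additive character of the two-element field, real-valued so that sums of
  signs are not reduced modulo 2.\<close>

definition bit_sign :: "bit \<Rightarrow> real" where
  "bit_sign b = (if b = 0 then 1 else -1)"

lemma bit_sign_add: "bit_sign (b + c) = bit_sign b * bit_sign c"
  by (cases b; cases c) (simp_all add: bit_sign_def)

lemma bit_vec_add_self: "(x :: bit ^ 'n) + x = 0"
  by (simp add: vec_eq_iff)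

lemma bit_vec_add_eq_0_iff: "(x :: bit ^ 'n) + y = 0 \<longleftrightarrow> x = y"
  by (metis add.commute add_left_imp_eq bit_vec_add_self)

lemma scalar_product_add_left:
  "scalar_product (x + y) (z :: 'a :: semiring_1 ^ 'n) = scalar_product x z + scalar_product y z"
  by (simp add: scalar_product_def sum.distrib distrib_right)

lemma scalar_product_add_right:
  "scalar_product (z :: 'a :: semiring_1 ^ 'n) (x + y) = scalar_product z x + scalar_product z y"
  by (simp add: scalar_product_def sum.distrib distrib_left)

lemma scalar_product_axis_right:
  "scalar_product (x :: 'a :: semiring_1 ^ 'n) (axis i 1) = x $ i"
  by (simp add: scalar_product_def axis_def if_distrib cong: if_cong)

lemma subspace_annihilator:
  "vec.subspace {x :: 'a :: field ^ 'n. \<forall>y\<in>C. scalar_product x y = 0}"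
proof (rule vec.subspaceI)
  show "c *s x \<in> {x. \<forall>y\<in>C. scalar_product x y = 0}"
    if "x \<in> {x. \<forall>y\<in>C. scalar_product x y = 0}" for c and x :: "'a ^ 'n"
    using that by (simp add: scalar_product_def mult.assoc flip: sum_distrib_left)
qed (simp_all add: scalar_product_def sum.distrib distrib_right)

text \<open>Orthogonality of characters: if \<open>z\<close> has a 1 in coordinate \<open>i\<close>,
  translating \<open>y\<close> by the unit vector \<open>axis i 1\<close> permutes all vectors and
  flips every sign, so the sum equals its own negative.\<close>

lemma sum_bit_sign_scalar_product_eq_0:
  fixes z :: "bit ^ 'n"
  assumes "z \<noteq> 0"
  shows "(\<Sum>y\<in>UNIV. bit_sign (scalar_product z y)) = 0"
proof -
  obtain i where i: "z $ i = 1"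
    using assms by (auto simp: vec_eq_iff)
  define e :: "bit ^ 'n" where "e = axis i 1"
  have "bij (\<lambda>y. y + e)"
    by (rule o_bij[where g = "\<lambda>y. y + e"]) (auto simp: add.assoc bit_vec_add_self)
  then have "(\<Sum>y\<in>UNIV. bit_sign (scalar_product z y)) = (\<Sum>y\<in>UNIV. bit_sign (scalar_product z (y + e)))"
    by (rule sum.reindex_bij_betw[symmetric])
  also have "\<dots> = - (\<Sum>y\<in>UNIV. bit_sign (scalar_product z y))"
    by (simp only: scalar_product_add_right bit_sign_add e_def scalar_product_axis_right i)
      (simp add: bit_sign_def[of 1] sum_negf)
  finally show ?thesis by simp
qed

text \<open>Balance splits \<open>S\<close> into equally many elements on the hyperplane, with sign
  1, and off it, with sign -1.\<close>

lemma sum_bit_sign_balanced: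
  fixes S :: "(bit ^ 'n) set"
  assumes "balanced_wrt y S"
  shows "(\<Sum>s\<in>S. bit_sign (scalar_product s y)) = 0"
proof -
  let ?H = "S \<inter> hyperplane y" and ?K = "S - hyperplane y"
  have "card S = card ?H + card ?K"
    by (metis card_Int_Diff finite)
  then have "real (card ?K) = real (card ?H)"
    using assms by (simp add: balanced_wrt_def)
  moreover have "(\<Sum>s\<in>S. bit_sign (scalar_product s y)) =
      (\<Sum>s\<in>?H. bit_sign (scalar_product s y)) + (\<Sum>s\<in>?K. bit_sign (scalar_product s y))"
    by (rule sum.Int_Diff) simp
  moreover have "(\<Sum>s\<in>?H. bit_sign (scalar_product s y)) = (\<Sum>s\<in>?H. 1)"
    by (rule sum.cong) (auto simp: hyperplane_def bit_sign_def)
  moreover have "(\<Sum>s\<in>?K. bit_sign (scalar_product s y)) = (\<Sum>s\<in>?K. -1)"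
    by (rule sum.cong) (auto simp: hyperplane_def bit_sign_def)
  ultimately show ?thesis by simp
qed

text \<open>Off the hyperplane the product can only be 1, since the field has two elements.\<close>

lemma constant_wrt_scalar_product_eq:
  assumes "constant_wrt y S" "s \<in> S" "t \<in> S"
  shows "scalar_product s y = scalar_product t y"
  using assms unfolding constant_wrt_def hyperplane_def
  by (cases "scalar_product s y"; cases "scalar_product t y") auto

theorem theorem3:
  fixes S :: "(bit ^ 'n) set"
  assumes "S \<noteq> {}"
    and "fully_balanced S"
  shows "vec.subspace S \<or> affine_subspace S"
proof -
  obtain a where a: "a \<in> S" using assms(1) by blast
  define C where "C = constant_set S"
  define W where "W = {x :: bit ^ 'n. \<forall>y\<in>C. scalar_product x y = 0}"
  have "S \<subseteq> (\<lambda>w. a + w) ` W"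
  proof
    fix s assume s: "s \<in> S"
    \<comment> \<open>In characteristic 2, \<open>a + s\<close> is the difference of
      \<open>s\<close> and \<open>a\<close>, whose products with any \<open>y\<close> in
      \<open>C\<close> agree and so cancel.\<close>
    have "a + s \<in> W"
      using constant_wrt_scalar_product_eq[OF _ a s]
      by (auto simp: W_def C_def constant_set_def scalar_product_add_left)
    moreover have "s = a + (a + s)"
      by (simp add: bit_vec_add_self flip: add.assoc)
    ultimately show "s \<in> (\<lambda>w. a + w) ` W" by blast
  qed
  moreover have "a + w \<in> S" if w: "w \<in> W" for w
  proof (rule ccontr)
    assume notin: "a + w \<notin> S"
    let ?g = "\<lambda>s y. bit_sign (scalar_product (a + w + s) y)"
    have "(\<Sum>y\<in>UNIV. \<Sum>s\<in>S. ?g s y) = (\<Sum>s\<in>S. \<Sum>y\<in>UNIV. ?g s y)"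
      by (rule sum.swap)
    \<comment> \<open>Each \<open>a + w + s\<close> is nonzero, as otherwise
      \<open>a + w = s\<close> would lie in \<open>S\<close>.\<close>
    also have "\<dots> = 0"
      using notin
      by (intro sum.neutral ballI sum_bit_sign_scalar_product_eq_0) (auto simp: bit_vec_add_eq_0_iff)
    finally have zero: "(\<Sum>y\<in>UNIV. \<Sum>s\<in>S. ?g s y) = 0" .
    have const: "(\<Sum>s\<in>S. ?g s y) = real (card S)" if y: "y \<in> C" for y
    proof -
      \<comment> \<open>The products of \<open>a\<close> and \<open>s\<close> with \<open>y\<close>
        cancel, and that of \<open>w\<close> is 0.\<close>
      have "?g s y = 1" if s: "s \<in> S" for s
        using constant_wrt_scalar_product_eq[OF _ s a, of y] y w
        by (simp add: C_def constant_set_def W_def scalar_product_add_left bit_sign_def)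
      then show ?thesis by simp
    qed
    have bal: "(\<Sum>s\<in>S. ?g s y) = 0" if "y \<notin> C" for y
    proof -
      have "balanced_wrt y S"
        using assms(2) that by (auto simp: fully_balanced_def C_def balancing_set_def)
      then have "(\<Sum>s\<in>S. bit_sign (scalar_product s y)) = 0"
        by (rule sum_bit_sign_balanced)
      \<comment> \<open>By multiplicativity the sign of the translation \<open>a + w\<close> factors
        out of the sum over \<open>s\<close>.\<close>
      then have "bit_sign (scalar_product (a + w) y) * (\<Sum>s\<in>S. bit_sign (scalar_product s y)) = 0"
        by (simp only: mult_zero_right)
      then show ?thesis
        unfolding scalar_product_add_left[of "a + w"] bit_sign_add sum_distrib_left .
    qed
    \<comment> \<open>The term at \<open>y = 0\<close> makes the total strictly positive; the others
      are only known to be nonnegative.\<close>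
    have "0 \<in> C"
      by (auto simp: C_def constant_set_def constant_wrt_def hyperplane_def scalar_product_def)
    then have "0 < (\<Sum>s\<in>S. ?g s 0)"
      using assms(1) by (simp only: const) (simp add: card_gt_0_iff)
    moreover have "0 \<le> (\<Sum>s\<in>S. ?g s y)" for y
      using const[of y] bal[of y] by (metis of_nat_0_le_iff order_refl)
    ultimately have "0 < (\<Sum>y\<in>UNIV. \<Sum>s\<in>S. ?g s y)"
      by (intro sum_pos2[of UNIV 0 "\<lambda>y. \<Sum>s\<in>S. ?g s y"] finite UNIV_I)
    then show False using zero by simp
  qed
  ultimately have "S = (\<lambda>w. a + w) ` W" by blast
  moreover have "vec.subspace W"
    unfolding W_def by (rule subspace_annihilator)
  ultimately show ?thesis
    unfolding affine_subspace_def by blast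
qed

end
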